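(* There exist an absolute constant $C>0$ and $n_0$ such that for every $n\ge n_0$, every integer $t$ with $8\ln n\le t\le n^{1/3}$, and every integer $s$ with $1\le s\le \frac{t}{8\ln n}$, there exists a binary (over $\mathbb{F}_2$) $(s,t)$-batch code of dimension $n$ with redundancy at most $C\,t^{3/2}\sqrt{n}$. Consequently $r(n;s,t)\le C\,t^{3/2}\sqrt n$ in this range.
   Context: $[m]=\{1,\dots,m\}$. A linear code $\mathcal{C}\subseteq\mathbb{F}^N$ of dimension $n$ is systematic if for every $\mathbf{x}\in\mathbb{F}^n$ there is a unique codeword whose first $n$ coordinates equal $\mathbf{x}$. A set $R\subseteq[N]$ is a recovering set for $i\in[n]$ if there are scalars $\lambda_k$ with $\mathbf{c}(i)=\sum_{k\in R}\lambda_k\mathbf{c}(k)$ for all $\mathbf{c}\in\mathcal{C}$. $(s,t)$-batch code ($1\le s\le t$): a systematic linear code of dimension $n$ such that for every choice of indices $i_1,\dots,i_s\in[n]$ (not necessarily distinct) and nonnegative integers $a_1,\dots,a_s$ with $\sum_j a_j=t$, there exist $t$ pairwise disjoint sets $R_{j,l}\subseteq[N]$ ($j\in[s]$, $l\in[a_j]$), each a recovering set for $i_j$. Redundancy is $N-n$; $r(n;s,t)$ is the minimum redundancy of an $(s,t)$-batch code of dimension $n$ over all finite fields. *)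

theory Defs
  imports "HOL-Analysis.Analysis" "HOL-Library.Z2"
begin

text \<open>Codewords are vectors over a field F, represented as functions
  nat => F whose support lies in the coordinate set [N] = {1..N}.
  Binary codes use the two-element field bit (HOL-Library.Z2).\<close>

definition linear_code :: "nat \<Rightarrow> (nat \<Rightarrow> 'a::comm_semiring_1) set \<Rightarrow> bool" where
  "linear_code N C \<longleftrightarrow>
     (\<forall>c\<in>C. \<forall>k. k \<notin> {1..N} \<longrightarrow> c k = 0) \<and>
     (\<lambda>_. 0) \<in> C \<and>
     (\<forall>c\<in>C. \<forall>d\<in>C. (\<lambda>k. c k + d k) \<in> C) \<and>
     (\<forall>a. \<forall>c\<in>C. (\<lambda>k. a * c k) \<in> C)"

definition systematic :: "nat \<Rightarrow> nat \<Rightarrow> (nat \<Rightarrow> 'a::comm_semiring_1) set \<Rightarrow> bool" where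
  "systematic N n C \<longleftrightarrow> n \<le> N \<and>
     (\<forall>x::nat \<Rightarrow> 'a. \<exists>!c. c \<in> C \<and> (\<forall>i\<in>{1..n}. c i = x i))"

definition recovering_set :: "(nat \<Rightarrow> 'a::comm_semiring_1) set \<Rightarrow> nat \<Rightarrow> nat \<Rightarrow> nat set \<Rightarrow> bool" where
  "recovering_set C N i R \<longleftrightarrow> R \<subseteq> {1..N} \<and>
     (\<exists>coef::nat \<Rightarrow> 'a. \<forall>c\<in>C. c i = (\<Sum>k\<in>R. coef k * c k))"

definition batch_code :: "nat \<Rightarrow> nat \<Rightarrow> nat \<Rightarrow> nat \<Rightarrow> (nat \<Rightarrow> 'a::comm_semiring_1) set \<Rightarrow> bool" where
  "batch_code N n s t C \<longleftrightarrow> 1 \<le> s \<and> s \<le> t \<and> linear_code N C \<and> systematic N n C \<and>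
     (\<forall>(idx::nat \<Rightarrow> nat) (a::nat \<Rightarrow> nat).
        (\<forall>j\<in>{1..s}. idx j \<in> {1..n}) \<and> (\<Sum>j=1..s. a j) = t \<longrightarrow>
        (\<exists>R::nat \<Rightarrow> nat \<Rightarrow> nat set.
           (\<forall>j\<in>{1..s}. \<forall>l\<in>{1..a j}. recovering_set C N (idx j) (R j l)) \<and>
           (\<forall>j\<in>{1..s}. \<forall>l\<in>{1..a j}. \<forall>j'\<in>{1..s}. \<forall>l'\<in>{1..a j'}.
              (j, l) \<noteq> (j', l') \<longrightarrow> R j l \<inter> R j' l' = {})))"

end

theory Submission
  imports Defs
begin

text \<open>
  Take \<open>m = 2 t\<close> partitions of the information coordinates \<open>{1..n}\<close> into \<open>M = \<lceil>8 sqrt (t n)\<rceil>\<close>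
  blocks of size at most about \<open>n / M\<close>, and append the parity of every block.  A coordinate \<open>i\<close> is
  recovered from the rest of any block containing it together with the parity of that block, which
  yields one candidate recovering set per partition.

  Requests are served greedily, one partition after the other.  The sets selected so far cover at
  most about \<open>t n / M\<close> coordinates, and for a partition drawn from a universal family the
  block of \<open>i\<close> meets them with probability at most \<open>1/16\<close>, whatever the earlier partitions were.
  Hence the potential \<open>\<Sum> 16 ^ (number of clashes)\<close>, summed over all request patterns and all
  requested coordinates, at most doubles with a suitable choice of the next partition.  There are at
  most \<open>n ^ (3 s) < 4 ^ t\<close> summands, so after \<open>2 t\<close> partitions the potential is below \<open>16 ^ t\<close>:
  every requested coordinate has met fewer than \<open>t\<close> clashes, and every request is served.
\<close>

section \<open>Parity-check extensions\<close>

definition parity_code :: "nat \<Rightarrow> nat \<Rightarrow> (nat \<Rightarrow> nat set) \<Rightarrow> (nat \<Rightarrow> bit) set" where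
  "parity_code n N S =
     {c. (\<forall>k. k \<notin> {1..N} \<longrightarrow> c k = 0) \<and> (\<forall>k\<in>{n<..N}. c k = (\<Sum>p\<in>S k. c p))}"

lemma linear_code_parity_code: "linear_code N (parity_code n N S)"
  unfolding linear_code_def
proof (intro conjI ballI allI impI)
  fix c d assume "c \<in> parity_code n N S" "d \<in> parity_code n N S"
  then show "(\<lambda>k. c k + d k) \<in> parity_code n N S"
    unfolding parity_code_def mem_Collect_eq sum.distrib by (metis add_0)
next
  fix a c assume "c \<in> parity_code n N S"
  then show "(\<lambda>k. a * c k) \<in> parity_code n N S"
    unfolding parity_code_def mem_Collect_eq sum_distrib_left[symmetric] by (metis mult_zero_right)
qed (auto simp: parity_code_def)

lemma systematic_parity_code:
  assumes "n \<le> N" and S: "\<And>k. k \<in> {n<..N} \<Longrightarrow> S k \<subseteq> {1..n}"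
  shows "systematic N n (parity_code n N S)"
  unfolding systematic_def
proof (intro conjI allI)
  fix x :: "nat \<Rightarrow> bit"
  define c where "c k = (if k \<in> {1..n} then x k else if k \<in> {n<..N} then \<Sum>p\<in>S k. x p else 0)" for k
  have sum_eq: "(\<Sum>p\<in>S k. d p) = (\<Sum>p\<in>S k. x p)"
    if "k \<in> {n<..N}" "\<forall>i\<in>{1..n}. d i = x i" for k d
    using S[OF that(1)] that(2) by (intro sum.cong) auto
  show "\<exists>!c. c \<in> parity_code n N S \<and> (\<forall>i\<in>{1..n}. c i = x i)"
  proof (rule ex1I[of _ c])
    have "c k = (\<Sum>p\<in>S k. c p)" if "k \<in> {n<..N}" for k
    proof -
      have "(\<Sum>p\<in>S k. c p) = (\<Sum>p\<in>S k. x p)"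
        by (rule sum_eq[OF that]) (simp add: c_def)
      with that show ?thesis by (simp add: c_def)
    qed
    then show "c \<in> parity_code n N S \<and> (\<forall>i\<in>{1..n}. c i = x i)"
      using \<open>n \<le> N\<close> by (auto simp: parity_code_def c_def)
  next
    fix d assume d: "d \<in> parity_code n N S \<and> (\<forall>i\<in>{1..n}. d i = x i)"
    show "d = c"
    proof
      fix k
      consider "k \<in> {1..n}" | "k \<in> {n<..N}" | "k \<notin> {1..N}" by force
      then show "d k = c k"
      proof cases
        case 2
        then have "d k = (\<Sum>p\<in>S k. x p)"
          using d sum_eq[OF 2, of d] by (auto simp: parity_code_def)
        with 2 show ?thesis by (simp add: c_def)
      next
        case 3
        with d \<open>n \<le> N\<close> show ?thesis by (auto simp: parity_code_def c_def)
      qed (use d in \<open>simp add: c_def\<close>)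
    qed
  qed
qed fact

text \<open>Substituting the check equation for \<open>c k\<close> makes every \<open>c p\<close>
  with \<open>p\<close> in \<open>S k - {i}\<close> occur twice. Over \<open>bit\<close> these pairs
  cancel and only \<open>c i\<close> is left.\<close>

lemma recovering_set_parity_code:
  assumes "n \<le> N" "k \<in> {n<..N}" "S k \<subseteq> {1..n}" "i \<in> S k"
  shows "recovering_set (parity_code n N S) N i (insert k (S k - {i}))"
  unfolding recovering_set_def
proof (intro conjI exI ballI)
  show "insert k (S k - {i}) \<subseteq> {1..N}" using assms by fastforce
  fix c assume "c \<in> parity_code n N S"
  then have "c k = (\<Sum>p\<in>S k. c p)" using assms(2) by (simp add: parity_code_def)
  moreover have fin: "finite (S k)" using assms(3) finite_subset by blast
  moreover have "k \<notin> S k" using assms(2,3) by auto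
  ultimately have "(\<Sum>p\<in>insert k (S k - {i}). c p) = c i + (\<Sum>p\<in>S k - {i}. c p) + (\<Sum>p\<in>S k - {i}. c p)"
    using assms(4) by (simp only: sum.remove[of "S k" i] sum.insert finite_Diff Diff_iff simp_thms)
  also have "\<dots> = c i" by auto
  finally show "c i = (\<Sum>p\<in>insert k (S k - {i}). 1 * c p)"
    by (simp only: mult_1)
qed

section \<open>Derandomised choice against adaptive bad events\<close>

text \<open>The predicate receives the earlier choices, so the events are adaptive: each choice is
  judged against the tail that was present when it was made.\<close>

fun bad_count :: "('h list \<Rightarrow> 'h \<Rightarrow> bool) \<Rightarrow> 'h list \<Rightarrow> nat" where
  "bad_count P [] = 0"
| "bad_count P (h # hs) = bad_count P hs + (if P hs h then 1 else 0)"

text \<open>The most recent choice is at the head of the list.\<close>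

lemma exists_choices_few_bad:
  fixes P :: "'k \<Rightarrow> 'h list \<Rightarrow> 'h \<Rightarrow> bool"
  assumes "finite H" "H \<noteq> {}"
    and rare: "\<And>\<kappa> hs. \<lbrakk>\<kappa> \<in> K; set hs \<subseteq> H\<rbrakk> \<Longrightarrow> card {h \<in> H. P \<kappa> hs h} * 16 \<le> card H"
  shows "\<exists>hs. set hs \<subseteq> H \<and> length hs = m \<and> (\<Sum>\<kappa>\<in>K. 16 ^ bad_count (P \<kappa>) hs) \<le> 2 ^ m * card K"
proof (induction m)
  case 0
  show ?case by (rule exI[of _ "[]"]) simp
next
  case (Suc m)
  then obtain hs where hs: "set hs \<subseteq> H" "length hs = m"
    and pot: "(\<Sum>\<kappa>\<in>K. 16 ^ bad_count (P \<kappa>) hs) \<le> 2 ^ m * card K" by blast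
  let ?\<Phi> = "\<lambda>hs. \<Sum>\<kappa>\<in>K. (16::nat) ^ bad_count (P \<kappa>) hs"
  have "(\<Sum>h\<in>H. ?\<Phi> (h # hs)) = (\<Sum>\<kappa>\<in>K. \<Sum>h\<in>H. 16 ^ bad_count (P \<kappa>) (h # hs))"
    by (rule sum.swap)
  also have "\<dots> \<le> (\<Sum>\<kappa>\<in>K. 16 ^ bad_count (P \<kappa>) hs * (2 * card H))"
  proof (rule sum_mono)
    fix \<kappa> assume "\<kappa> \<in> K"
    have "(\<Sum>h\<in>H. 16 ^ bad_count (P \<kappa>) (h # hs)) =
        16 ^ bad_count (P \<kappa>) hs * (\<Sum>h\<in>H. if P \<kappa> hs h then 16 else (1::nat))"
      by (simp add: sum_distrib_left, intro sum.cong) auto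
    \<comment> \<open>A bad choice multiplies a summand by 16, a good one by 1. At most one choice
      in 16 is bad, so the bad choices contribute at most \<open>card H\<close> and the average
      factor is at most 2.\<close>
    also have "(\<Sum>h\<in>H. if P \<kappa> hs h then 16 else (1::nat)) \<le> (\<Sum>h\<in>H. (if P \<kappa> hs h then 16 else 0) + 1)"
      by (intro sum_mono) simp
    also have "\<dots> = card {h \<in> H. P \<kappa> hs h} * 16 + card H"
      unfolding sum.distrib using \<open>finite H\<close> by (simp add: sum.If_cases Int_def)
    also have "\<dots> \<le> 2 * card H" using rare[OF \<open>\<kappa> \<in> K\<close> hs(1)] by simp
    finally show "(\<Sum>h\<in>H. 16 ^ bad_count (P \<kappa>) (h # hs)) \<le> 16 ^ bad_count (P \<kappa>) hs * (2 * card H)"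
      by simp
  qed
  also have "\<dots> = card H * (2 * ?\<Phi> hs)"
    by (simp add: sum_distrib_left sum_distrib_right algebra_simps)
  finally have avg: "(\<Sum>h\<in>H. ?\<Phi> (h # hs)) \<le> card H * (2 * ?\<Phi> hs)" .
  have "\<exists>h\<in>H. ?\<Phi> (h # hs) \<le> 2 * ?\<Phi> hs"
  proof (rule ccontr)
    assume "\<not> ?thesis"
    then have "(\<Sum>h\<in>H. 2 * ?\<Phi> hs) < (\<Sum>h\<in>H. ?\<Phi> (h # hs))"
      using assms(1,2) by (intro sum_strict_mono) (auto simp: not_le)
    with avg show False by simp
  qed
  then obtain h where "h \<in> H" "?\<Phi> (h # hs) \<le> 2 * ?\<Phi> hs" by blast
  with hs pot show ?case by (intro exI[of _ "h # hs"]) auto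
qed

section \<open>Greedy selection of blocks\<close>

text \<open>Each \<open>h\<close> induces one partition into \<open>M\<close> blocks.
  \<open>universal\<close> is collision probability at most 1/M for a uniform \<open>h\<close>, with
  the denominators cleared.\<close>

locale hash_family =
  fixes hash :: "'h \<Rightarrow> nat \<Rightarrow> nat" and H :: "'h set" and n M B :: nat
  assumes finite_H: "finite H" and H_ne: "H \<noteq> {}"
    and hash_less: "\<And>h p. hash h p < M"
    and balanced: "\<And>h v. h \<in> H \<Longrightarrow> card {p \<in> {1..n}. hash h p = v} \<le> B"
    and universal: "\<And>p q. \<lbrakk>p \<in> {1..n}; q \<in> {1..n}; p \<noteq> q\<rbrakk> \<Longrightarrow>
      card {h \<in> H. hash h p = hash h q} * M \<le> card H"
begin

text \<open>This is the information part of a recovering set for \<open>i\<close>; the parity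
  coordinate of the block joins it only in the final construction.\<close>

definition block :: "'h \<Rightarrow> nat \<Rightarrow> nat set" where
  "block h i = {p \<in> {1..n}. hash h p = hash h i} - {i}"

definition demands :: "nat \<Rightarrow> (nat \<Rightarrow> nat) set" where
  "demands t = {D. {i. D i \<noteq> 0} \<subseteq> {1..n} \<and> sum D {1..n} = t}"

definition covered :: "(nat \<times> nat \<times> 'h) set \<Rightarrow> nat set" where
  "covered A = (\<Union>(i, c, h)\<in>A. block h i)"

text \<open>Requested coordinates count as obstacles along with the covered ones. Hence coordinates
  served simultaneously by one partition lie in different blocks, with no order needed among
  them.\<close>

definition clash :: "(nat \<Rightarrow> nat) \<Rightarrow> (nat \<times> nat \<times> 'h) set \<Rightarrow> nat \<Rightarrow> 'h \<Rightarrow> bool" where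
  "clash D A i h \<longleftrightarrow> (\<exists>p \<in> (covered A \<union> {i. D i \<noteq> 0}) - {i}. hash h p = hash h i)"

text \<open>A triple \<open>(i, c, h)\<close> records that coordinate \<open>i\<close> is to be recovered from its block in the
  \<open>c\<close>-th partition, which is induced by \<open>h\<close>.\<close>

fun sel :: "(nat \<Rightarrow> nat) \<Rightarrow> 'h list \<Rightarrow> (nat \<times> nat \<times> 'h) set" where
  "sel D [] = {}"
| "sel D (h # hs) = sel D hs \<union>
     (\<lambda>i. (i, length hs, h)) `
       {i. card {e \<in> sel D hs. fst e = i} < D i \<and> \<not> clash D (sel D hs) i h}"

text \<open>Choices are prepended, so numbering the partitions from the oldest on, starting at 0,
  means indexing the reversed list.\<close>

lemma sel_mem:
  "(i, c, h) \<in> sel D hs \<Longrightarrow> c < length hs \<and> h = rev hs ! c \<and> D i \<noteq> 0"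
  by (induction hs) (auto simp: nth_append less_Suc_eq)

lemma sel_Cons_fibre:
  "{e \<in> sel D (h # hs). fst e = i} =
     (if card {e \<in> sel D hs. fst e = i} < D i \<and> \<not> clash D (sel D hs) i h
      then insert (i, length hs, h) {e \<in> sel D hs. fst e = i}
      else {e \<in> sel D hs. fst e = i})"
  by auto

lemma finite_sel:
  assumes "D \<in> demands t" shows "finite (sel D hs)"
proof (induction hs)
  case (Cons h hs)
  have "{i. card {e \<in> sel D hs. fst e = i} < D i \<and> \<not> clash D (sel D hs) i h} \<subseteq> {1..n}"
    using assms by (auto simp: demands_def)
  then have "finite {i. card {e \<in> sel D hs. fst e = i} < D i \<and> \<not> clash D (sel D hs) i h}"
    by (rule finite_subset) simp
  with Cons show ?case by simp
qed simp

lemma card_fibre_Cons: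
  assumes "D \<in> demands t"
  shows "card {e \<in> sel D (h # hs). fst e = i} = card {e \<in> sel D hs. fst e = i} +
     (if card {e \<in> sel D hs. fst e = i} < D i \<and> \<not> clash D (sel D hs) i h then 1 else 0)"
proof -
  have "(i, length hs, h) \<notin> sel D hs" using sel_mem by blast
  then show ?thesis using finite_sel[OF assms, of hs] unfolding sel_Cons_fibre by simp
qed

lemma card_fibre_le:
  assumes "D \<in> demands t" shows "card {e \<in> sel D hs. fst e = i} \<le> D i"
proof (induction hs)
  case (Cons h hs)
  then show ?case unfolding card_fibre_Cons[OF assms] by simp
qed simp

text \<open>As long as the demand of \<open>i\<close> is not met, every partition either serves
  \<open>i\<close> once more or is counted as a clash. A met demand stays met.\<close>

lemma card_fibre_eq_or_ge:
  assumes "D \<in> demands t"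
  shows "card {e \<in> sel D hs. fst e = i} = D i \<or>
    length hs \<le> card {e \<in> sel D hs. fst e = i} + bad_count (\<lambda>hs. clash D (sel D hs) i) hs"
proof (induction hs)
  case (Cons h hs)
  then show ?case
    using card_fibre_le[OF assms, of hs i] unfolding card_fibre_Cons[OF assms] by auto
qed simp

text \<open>A new block avoids the older ones because \<open>clash\<close> tests covered points, and
  its contemporaries because \<open>clash\<close> tests requested points. The claim on hash values
  separates the parity coordinates; disjoint blocks alone do not, since \<open>i\<close> and
  \<open>i'\<close> could together form one block.\<close>

lemma sel_disjoint:
  "\<lbrakk>(i, c, h) \<in> sel D hs; (i', c', h') \<in> sel D hs; (i, c, h) \<noteq> (i', c', h')\<rbrakk> \<Longrightarrow>
     block h i \<inter> block h' i' = {} \<and> (c = c' \<longrightarrow> hash h i \<noteq> hash h' i')"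
proof (induction hs arbitrary: i c h i' c' h')
  case (Cons g hs)
  have new_old: "block g j \<inter> block k i = {}"
    if "\<not> clash D (sel D hs) j g" "(i, c, k) \<in> sel D hs" for j i c k
  proof -
    have "block k i \<subseteq> covered (sel D hs)" using that(2) by (auto simp: covered_def)
    then show ?thesis using that(1) by (auto simp: clash_def block_def)
  qed
  have new_new: "hash g j \<noteq> hash g j'"
    if "\<not> clash D (sel D hs) j g" "D j' \<noteq> 0" "j \<noteq> j'" for j j'
    using that by (auto simp: clash_def)
  consider (old) "(i, c, h) \<in> sel D hs" "(i', c', h') \<in> sel D hs"
    | (l) "(i, c, h) \<in> sel D hs" "c' = length hs" "h' = g" "\<not> clash D (sel D hs) i' g"
    | (r) "(i', c', h') \<in> sel D hs" "c = length hs" "h = g" "\<not> clash D (sel D hs) i g"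
    | (new) "c = length hs" "h = g" "\<not> clash D (sel D hs) i g"
        "c' = length hs" "h' = g" "D i' \<noteq> 0"
    using Cons.prems(1,2) by auto
  then show ?case
  proof cases
    case old
    then show ?thesis using Cons by blast
  next
    case l
    then show ?thesis using new_old[of i' i c h] sel_mem[OF l(1)] by auto
  next
    case r
    then show ?thesis using new_old[of i i' c' h'] sel_mem[OF r(1)] by auto
  next
    case new
    then have "hash g i \<noteq> hash g i'" using Cons.prems(3) new_new by auto
    then show ?thesis using new by (auto simp: block_def)
  qed
qed simp

section \<open>Clash probability and simultaneous service of all demands\<close>

lemma card_sel_le:
  assumes "D \<in> demands t" shows "card (sel D hs) \<le> t"
proof -
  have "sel D hs = (\<Union>i\<in>{1..n}. {e \<in> sel D hs. fst e = i})"
    using assms sel_mem[of _ _ _ D hs] by (fastforce simp: demands_def)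
  then have "card (sel D hs) = card (\<Union>i\<in>{1..n}. {e \<in> sel D hs. fst e = i})"
    by (rule arg_cong)
  also have "\<dots> \<le> (\<Sum>i\<in>{1..n}. card {e \<in> sel D hs. fst e = i})"
    by (rule card_UN_le) simp
  also have "\<dots> \<le> sum D {1..n}" by (intro sum_mono card_fibre_le[OF assms])
  finally show ?thesis using assms by (simp add: demands_def)
qed

text \<open>Union bound: at most \<open>t * B\<close> covered and \<open>t\<close> requested points
  can obstruct \<open>i\<close>, and each shares the block of \<open>i\<close> with probability at
  most 1/M. The bound is uniform in the history \<open>hs\<close>, as the adaptive choice
  requires.\<close>

lemma card_clash_le:
  assumes D: "D \<in> demands t" and hs: "set hs \<subseteq> H" and i: "i \<in> {1..n}"
  shows "card {h \<in> H. clash D (sel D hs) i h} * M \<le> t * (B + 1) * card H"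
proof -
  define U where "U = (covered (sel D hs) \<union> {i. D i \<noteq> 0}) - {i}"
  have U: "U \<subseteq> {1..n}" "i \<notin> U"
    using D by (auto simp: U_def covered_def block_def demands_def)
  then have finU: "finite U" using finite_subset by blast
  have "card (block h j) \<le> B" if "(j, c, h) \<in> sel D hs" for j c h
  proof -
    have "h \<in> H" using sel_mem[OF that] hs by (metis length_rev nth_mem set_rev subsetD)
    then have "card {p \<in> {1..n}. hash h p = hash h j} \<le> B" by (rule balanced)
    moreover have "card (block h j) \<le> card {p \<in> {1..n}. hash h p = hash h j}"
      unfolding block_def by (intro card_mono) auto
    ultimately show ?thesis by simp
  qed
  then have "(\<Sum>(j, c, h)\<in>sel D hs. card (block h j)) \<le> card (sel D hs) * B"
    by (intro sum_bounded_above[where K = B, simplified]) auto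
  moreover have "card (covered (sel D hs)) \<le> (\<Sum>(j, c, h)\<in>sel D hs. card (block h j))"
    unfolding covered_def using card_UN_le[OF finite_sel[OF D], of "\<lambda>(j, c, h). block h j" hs]
    by (simp add: case_prod_unfold)
  ultimately have cov: "card (covered (sel D hs)) \<le> t * B"
    using card_sel_le[OF D, of hs] by (meson le_trans mult_le_mono1)
  have "card {i. D i \<noteq> 0} = (\<Sum>i\<in>{i. D i \<noteq> 0}. 1)" by simp
  also have "\<dots> \<le> (\<Sum>i\<in>{i. D i \<noteq> 0}. D i)" by (intro sum_mono) auto
  also have "\<dots> \<le> sum D {1..n}" using D by (intro sum_mono2) (auto simp: demands_def)
  also have "\<dots> = t" using D by (simp add: demands_def)
  finally have supp: "card {i. D i \<noteq> 0} \<le> t" .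
  have "finite (covered (sel D hs) \<union> {i. D i \<noteq> 0})"
    using finU by (simp add: U_def)
  then have "card U \<le> card (covered (sel D hs) \<union> {i. D i \<noteq> 0})"
    unfolding U_def by (intro card_mono) auto
  also have "\<dots> \<le> t * B + t"
    using cov supp by (meson add_mono card_Un_le le_trans)
  finally have cardU: "card U \<le> t * (B + 1)" by simp
  have "{h \<in> H. clash D (sel D hs) i h} = (\<Union>p\<in>U. {h \<in> H. hash h p = hash h i})"
    by (auto simp: clash_def U_def)
  then have "card {h \<in> H. clash D (sel D hs) i h} * M \<le>
      (\<Sum>p\<in>U. card {h \<in> H. hash h p = hash h i}) * M"
    by (simp only: card_UN_le[OF finU] mult_le_mono1)
  also have "\<dots> = (\<Sum>p\<in>U. card {h \<in> H. hash h p = hash h i} * M)"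
    by (rule sum_distrib_right)
  also have "\<dots> \<le> (\<Sum>p\<in>U. card H)"
    using U i by (intro sum_mono universal) auto
  also have "\<dots> \<le> t * (B + 1) * card H" using cardU by (simp add: mult_le_mono1)
  finally show ?thesis .
qed

text \<open>The hypothesis on \<open>M\<close> turns the clash probability into 1/16, and
  \<open>few\<close> keeps the final potential below \<open>16 ^ t\<close>. Fewer than
  \<open>t\<close> clashes among \<open>2 * t\<close> partitions leave more than \<open>t\<close>
  chances, enough for any \<open>D i\<close>.\<close>

lemma exists_serving_hashes:
  assumes M: "16 * (t * (B + 1)) \<le> M" and E: "finite E" "E \<subseteq> demands t"
    and few: "card E * n < 4 ^ t"
  shows "\<exists>hs. set hs \<subseteq> H \<and> length hs = 2 * t \<and>
    (\<forall>D\<in>E. \<forall>i\<in>{1..n}. card {e \<in> sel D hs. fst e = i} = D i)"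
proof -
  let ?P = "\<lambda>(D, i) hs. clash D (sel D hs) i"
  have "M > 0" using hash_less[of undefined 0] by simp
  have rare: "card {h \<in> H. ?P \<kappa> hs h} * 16 \<le> card H" if mem: "\<kappa> \<in> E \<times> {1..n}" "set hs \<subseteq> H" for \<kappa> hs
  proof -
    obtain D i where \<kappa>: "\<kappa> = (D, i)" "D \<in> demands t" "i \<in> {1..n}" using mem(1) E by blast
    have "card {h \<in> H. clash D (sel D hs) i h} * 16 * M \<le> 16 * (t * (B + 1)) * card H"
      using card_clash_le[OF \<kappa>(2) mem(2) \<kappa>(3)] by (simp add: algebra_simps)
    also have "\<dots> \<le> card H * M" using M by (simp add: mult.commute)
    finally show ?thesis using \<open>M > 0\<close> \<kappa>(1) by simp
  qed
  from exists_choices_few_bad[of H "E \<times> {1..n}" ?P, OF finite_H H_ne rare]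
  obtain hs where hs: "set hs \<subseteq> H" "length hs = 2 * t"
    and pot: "(\<Sum>\<kappa>\<in>E \<times> {1..n}. 16 ^ bad_count (?P \<kappa>) hs) \<le> 2 ^ (2 * t) * card (E \<times> {1..n})"
    by blast
  have "card {e \<in> sel D hs. fst e = i} = D i" if "D \<in> E" "i \<in> {1..n}" for D i
  proof -
    have "16 ^ bad_count (?P (D, i)) hs \<le> (\<Sum>\<kappa>\<in>E \<times> {1..n}. 16 ^ bad_count (?P \<kappa>) hs :: nat)"
      using that E(1) by (intro member_le_sum) auto
    also have "\<dots> \<le> 4 ^ t * (card E * n)"
      using pot by (simp add: power_mult card_cartesian_product)
    also have "\<dots> < 4 ^ t * 4 ^ t" using few by simp
    also have "\<dots> = (16::nat) ^ t" by (simp flip: power_mult_distrib)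
    finally have "bad_count (?P (D, i)) hs < t" by simp
    \<comment> \<open>The second alternative merely postpones the bound of \<open>D i\<close> by the
      total demand \<open>t\<close>, which excludes it below.\<close>
    then have "length hs > D i + bad_count (?P (D, i)) hs \<or> D i > t" using hs(2) by auto
    moreover have D: "D \<in> demands t" using that(1) E(2) by blast
    then have "D i \<le> t" using member_le_sum[OF that(2), of D] by (simp add: demands_def)
    ultimately show ?thesis
      using card_fibre_eq_or_ge[OF D, of hs i] card_fibre_le[OF D, of hs i] by auto
  qed
  with hs show ?thesis by blast
qed

end

section \<open>Column shifts as a universal family\<close>

text \<open>Write the numbers into consecutive columns of height \<open>M\<close> and rotate column
  \<open>x\<close> cyclically by \<open>u x\<close>. The blocks are the resulting rows.\<close>

definition shift_hash :: "nat \<Rightarrow> (nat \<Rightarrow> nat) \<Rightarrow> nat \<Rightarrow> nat" where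
  "shift_hash M u p = (p + u (p div M)) mod M"

lemma mod_add_right_cancel_nat:
  fixes a b c M :: nat
  assumes "(a + c) mod M = (b + c) mod M" shows "a mod M = b mod M"
proof -
  have "(int a + int c) mod int M = (int b + int c) mod int M"
    using assms by (metis of_nat_add zmod_int)
  then have "int a mod int M = int b mod int M"
    by (metis add_diff_cancel_right' mod_diff_left_eq)
  then show ?thesis by (metis of_nat_eq_iff zmod_int)
qed

text \<open>A rotation is injective on its column, so a row meets each column at most once. This
  bounds the block size by the number of columns and rules out collisions within a column.\<close>

lemma shift_hash_eq_same_column:
  assumes "shift_hash M u p = shift_hash M u q" "p div M = q div M"
  shows "p = q"
proof -
  have "p mod M = q mod M"
    using assms mod_add_right_cancel_nat[of p "u (q div M)" M q] by (simp add: shift_hash_def)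
  with assms(2) show ?thesis by (metis div_mult_mod_eq)
qed

lemma shift_hash_family:
  assumes "M > 0"
  shows "hash_family (shift_hash M) (PiE {..n div M} (\<lambda>_. {..<M})) n M (n div M + 1)"
proof
  let ?H = "PiE {..n div M} (\<lambda>_. {..<M})"
  show "finite ?H" by (simp add: finite_PiE)
  show "?H \<noteq> {}" using assms by (auto simp: PiE_eq_empty_iff)
  show "shift_hash M u p < M" for u p using assms by (simp add: shift_hash_def)
  show "card {p \<in> {1..n}. shift_hash M u p = v} \<le> n div M + 1" for u v
  proof -
    have "inj_on (\<lambda>p. p div M) {p \<in> {1..n}. shift_hash M u p = v}"
      by (intro inj_onI, rule shift_hash_eq_same_column[where M = M and u = u]) auto
    moreover have "(\<lambda>p. p div M) ` {p \<in> {1..n}. shift_hash M u p = v} \<subseteq> {..n div M}"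
      by (auto intro: div_le_mono)
    ultimately have "card {p \<in> {1..n}. shift_hash M u p = v} \<le> card {..n div M}"
      by (intro card_inj_on_le) auto
    then show ?thesis by simp
  qed
  fix p q assume pq: "p \<in> {1..n}" "q \<in> {1..n}" "p \<noteq> q"
  let ?x = "p div M" and ?y = "q div M"
  let ?Z = "{u \<in> ?H. shift_hash M u p = shift_hash M u q}"
  show "card ?Z * M \<le> card ?H"
  proof (cases "?x = ?y")
    case True
    then have "?Z = {}" using shift_hash_eq_same_column pq(3) by blast
    then show ?thesis by (simp only: card.empty mult_0 le0)
  next
    case False
    have x: "?x \<in> {..n div M}" using pq by (auto intro: div_le_mono)
    \<comment> \<open>Overwriting the shift of column \<open>?x\<close> loses nothing for a
      colliding \<open>u\<close>: the collision determines \<open>u ?x\<close> from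
      \<open>u ?y\<close>, which survives. So each colliding \<open>u\<close> accounts for
      \<open>M\<close> members of \<open>?H\<close>.\<close>
    have "inj_on (\<lambda>(u, v). u(?x := v)) (?Z \<times> {..<M})"
    proof (rule inj_onI, clarify)
      fix u v u' v'
      assume u: "u \<in> ?H" "shift_hash M u p = shift_hash M u q" "v < M"
        and u': "u' \<in> ?H" "shift_hash M u' p = shift_hash M u' q" "v' < M"
        and eq: "u(?x := v) = u'(?x := v')"
      have off: "u k = u' k" if "k \<noteq> ?x" for k using fun_cong[OF eq, of k] that by simp
      have "(u ?x + p) mod M = (u' ?x + p) mod M"
        using u(2) u'(2) off[of ?y] False by (simp add: shift_hash_def add.commute)
      then have "u ?x mod M = u' ?x mod M" by (rule mod_add_right_cancel_nat)
      moreover have "u ?x < M" "u' ?x < M" using u(1) u'(1) x by (auto dest: PiE_mem)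
      ultimately have "u ?x = u' ?x" by simp
      with off have "u = u'" by (intro ext) metis
      moreover have "v = v'" using fun_cong[OF eq, of ?x] by simp
      ultimately show "u = u' \<and> v = v'" by simp
    qed
    moreover have "(\<lambda>(u, v). u(?x := v)) ` (?Z \<times> {..<M}) \<subseteq> ?H"
      using x by (auto simp: PiE_iff extensional_def split: if_splits)
    ultimately have "card (?Z \<times> {..<M}) \<le> card ?H"
      by (intro card_inj_on_le) (auto simp: finite_PiE)
    then show ?thesis by (simp add: card_cartesian_product)
  qed
qed

section \<open>The batch code\<close>

text \<open>Indices may repeat in a request, so the multiplicities belonging to the same coordinate
  are added up.\<close>

definition demand_of :: "nat \<Rightarrow> (nat \<Rightarrow> nat) \<Rightarrow> (nat \<Rightarrow> nat) \<Rightarrow> nat \<Rightarrow> nat" where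
  "demand_of s idx a i = (\<Sum>j | j \<in> {1..s} \<and> idx j = i. a j)"

context hash_family
begin

lemma demand_of_demands:
  assumes "\<forall>j\<in>{1..s}. idx j \<in> {1..n}" "(\<Sum>j=1..s. a j) = t"
  shows "demand_of s idx a \<in> demands t"
proof -
  have "i \<in> {1..n}" if nz: "demand_of s idx a i \<noteq> 0" for i
  proof (rule ccontr)
    assume "i \<notin> {1..n}"
    with assms(1) have "{j \<in> {1..s}. idx j = i} = {}" by auto
    then have "demand_of s idx a i = 0" unfolding demand_of_def by (simp only: sum.empty)
    with nz show False by simp
  qed
  moreover have "sum (demand_of s idx a) {1..n} = t"
    unfolding demand_of_def using sum.group[of "{1..s}" "{1..n}" idx a] assms by force
  ultimately show ?thesis by (auto simp: demands_def)
qed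

text \<open>Only the values on \<open>{1..s}\<close> matter, and each \<open>a j\<close> is at most
  \<open>t\<close>. Restricting both functions leaves finitely many pairs to count.\<close>

lemma card_demands_of_le:
  fixes s t :: nat
  defines "E \<equiv> {D. \<exists>idx a. (\<forall>j\<in>{1..s}. idx j \<in> {1..n}) \<and> (\<Sum>j=1..s. a j) = t \<and> D = demand_of s idx a}"
  shows "finite E" "card E \<le> n ^ s * (t + 1) ^ s"
proof -
  let ?X = "PiE {1..s} (\<lambda>_. {1..n}) \<times> PiE {1..s} (\<lambda>_. {..t})"
  have sub: "E \<subseteq> (\<lambda>(idx, a). demand_of s idx a) ` ?X"
  proof
    fix D assume "D \<in> E"
    then obtain idx a where idx: "\<forall>j\<in>{1..s}. idx j \<in> {1..n}" and a: "(\<Sum>j=1..s. a j) = t"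
      and D: "D = demand_of s idx a" by (auto simp: E_def)
    have "a j \<le> t" if "j \<in> {1..s}" for j using a member_le_sum[OF that, of a] by simp
    then have "(restrict idx {1..s}, restrict a {1..s}) \<in> ?X" using idx by auto
    moreover have "D = demand_of s (restrict idx {1..s}) (restrict a {1..s})"
      unfolding D demand_of_def by (intro ext sum.cong) auto
    ultimately show "D \<in> (\<lambda>(idx, a). demand_of s idx a) ` ?X"
      by (metis (mono_tags, lifting) case_prod_conv image_eqI)
  qed
  have fin: "finite ?X" by (simp add: finite_PiE)
  with sub show "finite E" by (meson finite_imageI finite_subset)
  have "card E \<le> card ?X"
    using fin sub by (meson card_image_le card_mono finite_imageI le_trans)
  then show "card E \<le> n ^ s * (t + 1) ^ s" by (simp add: card_cartesian_product card_PiE)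
qed

lemma exists_batch_code:
  assumes M: "16 * (t * (B + 1)) \<le> M" and st: "1 \<le> s" "s \<le> t"
    and few: "n ^ s * (t + 1) ^ s * n < 4 ^ t"
  shows "\<exists>Cd :: (nat \<Rightarrow> bit) set. batch_code (n + 2 * t * M) n s t Cd"
proof -
  define E where "E = {D. \<exists>idx a. (\<forall>j\<in>{1..s}. idx j \<in> {1..n}) \<and> (\<Sum>j=1..s. a j) = t \<and>
    D = demand_of s idx a}"
  have E: "finite E" "card E \<le> n ^ s * (t + 1) ^ s"
    unfolding E_def by (rule card_demands_of_le)+
  have "E \<subseteq> demands t" using demand_of_demands by (auto simp: E_def)
  moreover have "card E * n < 4 ^ t" using E(2) few by (meson le_less_trans mult_le_mono1)
  ultimately obtain hs where hs: "set hs \<subseteq> H" "length hs = 2 * t"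
    and served: "\<And>D i. \<lbrakk>D \<in> E; i \<in> {1..n}\<rbrakk> \<Longrightarrow> card {e \<in> sel D hs. fst e = i} = D i"
    using exists_serving_hashes[OF M E(1)] by blast
  define N where "N = n + 2 * t * M"
  \<comment> \<open>Parity coordinates follow the \<open>n\<close> information coordinates,
    \<open>M\<close> per partition. Partitions and hash values count from 0 but coordinates from 1,
    hence the \<open>+ 1\<close>; \<open>S\<close> decodes the position by \<open>div\<close> and
    \<open>mod\<close>.\<close>
  define pos where "pos c v = n + 1 + c * M + v" for c v
  define S where "S k = {p \<in> {1..n}. hash (rev hs ! ((k - n - 1) div M)) p = (k - n - 1) mod M}" for k
  define rset where "rset = (\<lambda>(i, c, h). insert (pos c (hash h i)) (block h i))"
  let ?C = "parity_code n N S"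
  have S_pos: "S (pos c v) = {p \<in> {1..n}. hash (rev hs ! c) p = v}" if "v < M" for c v
    using that by (simp add: S_def pos_def)
  have pos_le: "pos c v \<in> {n<..N}" if "v < M" "c < 2 * t" for c v
  proof -
    have "c * M + v < (c + 1) * M" using that(1) by simp
    also have "\<dots> \<le> 2 * t * M" using that(2) by (intro mult_le_mono1) simp
    finally show ?thesis by (simp add: pos_def N_def)
  qed
  have pos_inj: "c = c' \<and> v = v'" if "pos c v = pos c' v'" "v < M" "v' < M" for c v c' v'
  proof -
    have eq: "c * M + v = c' * M + v'" using that(1) by (simp add: pos_def)
    from arg_cong[OF eq, of "\<lambda>x. x div M"] arg_cong[OF eq, of "\<lambda>x. x mod M"]
    show ?thesis using that(2,3) by simp
  qed
  have rec: "recovering_set ?C N i (rset (i, c, h))"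
    if "(i, c, h) \<in> sel D hs" "D \<in> demands t" for D i c h
  proof -
    have mem: "c < 2 * t" "h = rev hs ! c" "i \<in> {1..n}"
      using sel_mem[OF that(1)] hs(2) that(2) by (auto simp: demands_def)
    have Sp: "S (pos c (hash h i)) = {p \<in> {1..n}. hash h p = hash h i}"
      using S_pos[OF hash_less] mem(2) by simp
    have "recovering_set ?C N i (insert (pos c (hash h i)) (S (pos c (hash h i)) - {i}))"
      by (rule recovering_set_parity_code)
        (use mem pos_le[OF hash_less] Sp in \<open>auto simp: N_def\<close>)
    then show ?thesis by (simp add: rset_def block_def Sp)
  qed
  have disj: "rset e \<inter> rset e' = {}" if "e \<in> sel D hs" "e' \<in> sel D hs" "e \<noteq> e'" for D e e'
  proof -
    obtain i c h i' c' h' where e: "e = (i, c, h)" "e' = (i', c', h')" by (metis prod_cases3)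
    have "block h i \<inter> block h' i' = {}" "c = c' \<longrightarrow> hash h i \<noteq> hash h' i'"
      using sel_disjoint that unfolding e by blast+
    moreover have "pos c (hash h i) \<noteq> pos c' (hash h' i')"
      using calculation(2) pos_inj hash_less by blast
    moreover have "pos c v \<notin> block h i" for c v h i by (simp add: pos_def block_def)
    ultimately show ?thesis by (auto simp: rset_def e)
  qed
  have "batch_code N n s t ?C"
    unfolding batch_code_def
  proof (intro conjI allI impI)
    show "1 \<le> s" "s \<le> t" by fact+
    show "linear_code N ?C" by (rule linear_code_parity_code)
    show "systematic N n ?C" by (rule systematic_parity_code) (auto simp: N_def S_def)
    fix idx a :: "nat \<Rightarrow> nat"
    assume req: "(\<forall>j\<in>{1..s}. idx j \<in> {1..n}) \<and> (\<Sum>j=1..s. a j) = t"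
    define D where "D = demand_of s idx a"
    have D: "D \<in> demands t" "D \<in> E" using demand_of_demands req by (auto simp: D_def E_def)
    \<comment> \<open>All individual requests for coordinate \<open>i\<close>, possibly from several
      \<open>j\<close>. There are exactly \<open>D i\<close> of them, as many as triples selected
      for \<open>i\<close>, so a bijection assigns the recovering sets.\<close>
    define J where "J i = (SIGMA j:{j \<in> {1..s}. idx j = i}. {1..a j})" for i
    have "\<exists>f. bij_betw f (J i) {e \<in> sel D hs. fst e = i}" if "i \<in> {1..n}" for i
    proof (rule finite_same_card_bij)
      have "card (J i) = D i" unfolding J_def D_def demand_of_def by (subst card_SigmaI) auto
      then show "card (J i) = card {e \<in> sel D hs. fst e = i}" using served[OF D(2) that] by simp
    qed (use finite_sel[OF D(1)] in \<open>auto simp: J_def\<close>)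
    then obtain f where f: "\<And>i. i \<in> {1..n} \<Longrightarrow> bij_betw (f i) (J i) {e \<in> sel D hs. fst e = i}"
      by metis
    let ?e = "\<lambda>j l. f (idx j) (j, l)"
    have e_mem: "?e j l \<in> sel D hs \<and> fst (?e j l) = idx j" if "j \<in> {1..s}" "l \<in> {1..a j}" for j l
      using bij_betwE[OF f[of "idx j"]] that req by (auto simp: J_def)
    have e_inj: "(j, l) = (j', l')" if "j \<in> {1..s}" "l \<in> {1..a j}" "j' \<in> {1..s}" "l' \<in> {1..a j'}"
      "?e j l = ?e j' l'" for j l j' l'
    proof -
      have same: "idx j = idx j'" using e_mem that by metis
      have "inj_on (f (idx j)) (J (idx j))"
        using f[of "idx j"] req that(1) by (simp add: bij_betw_def)
      then show ?thesis
        by (rule inj_onD) (use that same in \<open>auto simp: J_def\<close>)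
    qed
    show "\<exists>R. (\<forall>j\<in>{1..s}. \<forall>l\<in>{1..a j}. recovering_set ?C N (idx j) (R j l)) \<and>
      (\<forall>j\<in>{1..s}. \<forall>l\<in>{1..a j}. \<forall>j'\<in>{1..s}. \<forall>l'\<in>{1..a j'}.
         (j, l) \<noteq> (j', l') \<longrightarrow> R j l \<inter> R j' l' = {})"
    proof (intro exI[of _ "\<lambda>j l. rset (?e j l)"] conjI ballI impI)
      fix j l assume "j \<in> {1..s}" "l \<in> {1..a j}"
      with e_mem rec[OF _ D(1)] show "recovering_set ?C N (idx j) (rset (?e j l))"
        by (metis prod.collapse)
    next
      fix j l j' l'
      assume jl: "j \<in> {1..s}" "l \<in> {1..a j}" "j' \<in> {1..s}" "l' \<in> {1..a j'}" "(j, l) \<noteq> (j', l')"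
      show "rset (?e j l) \<inter> rset (?e j' l') = {}"
        by (rule disj) (use jl e_mem e_inj in blast)+
    qed
  qed
  then show ?thesis by (auto simp: N_def)
qed

end

section \<open>Numerical estimates and choice of parameters\<close>

lemma exp_three_eighths_less: "exp (3 / 8 :: real) < 4"
proof -
  have "exp (3 / 8 :: real) \<le> exp 1" by simp
  also have "\<dots> < 4" using e_less_272 by simp
  finally show ?thesis .
qed

text \<open>Each of the three factors is at most \<open>n ^ s\<close>. Their product is at most
  exp(3 s ln n), hence at most exp(3 t / 8), and exp(3 / 8) is below 4.\<close>

lemma request_count_less:
  fixes n s t :: nat
  assumes "1 \<le> s" "t + 1 \<le> n" "0 < t" and ln: "8 * (real s * ln (real n)) \<le> real t"
  shows "n ^ s * (t + 1) ^ s * n < 4 ^ t"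
proof -
  have "n ^ s * (t + 1) ^ s * n \<le> n ^ s * n ^ s * n ^ s"
    using assms by (intro mult_le_mono power_mono) (auto simp: self_le_power)
  also have "\<dots> = n ^ (3 * s)" by (simp add: numeral_3_eq_3 add.assoc flip: power_add)
  finally have "real (n ^ s * (t + 1) ^ s * n) \<le> real n ^ (3 * s)"
    by (metis of_nat_le_iff of_nat_power)
  also have "\<dots> = exp (real (3 * s) * ln (real n))"
    using assms(2) by (simp add: exp_of_nat_mult del: of_nat_mult)
  also have "\<dots> \<le> exp (real t * (3 / 8))" using ln by simp
  also have "\<dots> = exp (3 / 8) ^ t" by (rule exp_of_nat_mult)
  also have "\<dots> < 4 ^ t"
    using exp_three_eighths_less \<open>0 < t\<close> by (intro power_strict_mono) auto
  finally show ?thesis by (metis of_nat_less_iff of_nat_numeral of_nat_power)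
qed

text \<open>With \<open>r\<close> the square root of \<open>t n\<close>, the hypotheses give
  \<open>8 t \<le> r\<close>. The left side of the second claim is then at most
  \<open>2 r + 4 r\<close>, below \<open>8 r \<le> M\<close>. Rounding up costs at most
  \<open>r\<close>, so \<open>M \<le> 9 r\<close>, which yields the constant 18.\<close>

lemma block_number_bounds:
  fixes n t :: nat
  assumes "8 \<le> t" "64 * t \<le> n"
  defines "M \<equiv> nat \<lceil>8 * sqrt (real t * real n)\<rceil>"
  shows "0 < M" "16 * (t * (n div M + 1 + 1)) \<le> M"
    "real (2 * t * M) \<le> 18 * real t powr (3 / 2) * sqrt (real n)"
proof -
  define r where "r = sqrt (real t * real n)"
  have r2: "r * r = real t * real n" by (simp add: r_def)
  have "(8 * real t)\<^sup>2 \<le> real t * real n"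
    using mult_left_mono[of "64 * real t" "real n" "real t"] assms(2)
    by (simp add: power2_eq_square)
  then have r_ge: "8 * real t \<le> r" unfolding r_def by (rule real_le_rsqrt)
  then have r1: "1 \<le> r" using assms(1) by linarith
  have M: "8 * r \<le> real M" "real M \<le> 8 * r + 1"
    unfolding M_def r_def[symmetric] using r1 by linarith+
  then show "0 < M" using r1 by linarith
  have "real (n div M) \<le> real n / real M" by (rule of_nat_div_le_of_nat)
  also have "\<dots> \<le> real n / (8 * r)" using M r1 by (intro divide_left_mono) auto
  finally have "real t * real (n div M) \<le> real t * (real n / (8 * r))" by (intro mult_left_mono) auto
  also have "\<dots> = r / 8" using r1 r2 by (simp add: field_simps)
  finally have "16 * (real t * real (n div M)) + 32 * real t \<le> real M"
    using M(1) r_ge by linarith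
  then have "real (16 * (t * (n div M + 1 + 1))) \<le> real M" by (simp add: algebra_simps)
  then show "16 * (t * (n div M + 1 + 1)) \<le> M" by (simp only: of_nat_le_iff)
  have "real (2 * t * M) = 2 * real t * real M" by simp
  also have "\<dots> \<le> 2 * real t * (9 * r)" using M(2) r1 by (intro mult_left_mono) auto
  also have "\<dots> = 18 * (real t powr 1 * real t powr (1 / 2)) * sqrt (real n)"
    using assms(1) by (simp add: r_def real_sqrt_mult powr_half_sqrt)
  also have "real t powr 1 * real t powr (1 / 2) = real t powr (3 / 2)"
    unfolding powr_add[symmetric] by simp
  finally show "real (2 * t * M) \<le> 18 * real t powr (3 / 2) * sqrt (real n)" .
qed

theorem theorem5:
  shows "\<exists>C::real. C > 0 \<and> (\<exists>n0::nat. \<forall>n\<ge>n0. \<forall>t::nat. \<forall>s::nat.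
     8 * ln (real n) \<le> real t \<and> real t \<le> real n powr (1/3) \<and>
     1 \<le> s \<and> real s \<le> real t / (8 * ln (real n)) \<longrightarrow>
     (\<exists>(N::nat) (Cd :: (nat \<Rightarrow> bit) set).
        batch_code N n s t Cd \<and> real N - real n \<le> C * real t powr (3/2) * sqrt (real n)))"
\<comment> \<open>The threshold 3 exceeds e, so \<open>ln n\<close> is at least 1 and
  \<open>t\<close> at least 8.\<close>
proof (rule exI[of _ 18], rule conjI, simp, rule exI[of _ 3], intro allI impI)
  fix n t s :: nat
  assume "3 \<le> n" and "8 * ln (real n) \<le> real t \<and> real t \<le> real n powr (1/3) \<and>
     1 \<le> s \<and> real s \<le> real t / (8 * ln (real n))"
  then have t: "8 * ln (real n) \<le> real t" "real t \<le> real n powr (1/3)"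
    and s: "1 \<le> s" "real s \<le> real t / (8 * ln (real n))" by auto
  have "exp 1 \<le> real n" using e_less_272 \<open>3 \<le> n\<close> by linarith
  then have ln1: "1 \<le> ln (real n)" using \<open>3 \<le> n\<close> by (simp add: ln_ge_iff)
  then have t8: "8 \<le> t" using t(1) by linarith
  have sln: "8 * (real s * ln (real n)) \<le> real t"
    using s(2) ln1 by (simp add: field_simps)
  moreover have "real s * 1 \<le> real s * ln (real n)" using ln1 by (intro mult_left_mono) auto
  ultimately have "s \<le> t" by linarith
  have "real t ^ 3 \<le> (real n powr (1/3)) ^ 3" using t(2) by (intro power_mono) auto
  also have "\<dots> = real n" using \<open>3 \<le> n\<close> by (simp flip: powr_realpow add: powr_powr)
  finally have "t ^ 3 \<le> n" by (metis of_nat_le_iff of_nat_power)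
  \<comment> \<open>Together with \<open>t ^ 3 \<le> n\<close> this gives
    \<open>64 * t \<le> n\<close>, the condition under which the \<open>32 t\<close> term in the
    block bound is absorbed.\<close>
  moreover have "8 * 8 * t \<le> t * t * t" using t8 by (intro mult_le_mono) auto
  ultimately have tn: "64 * t \<le> n" unfolding power3_eq_cube by linarith
  define M where "M = nat \<lceil>8 * sqrt (real t * real n)\<rceil>"
  note M = block_number_bounds[OF t8 tn, folded M_def]
  interpret hash_family "shift_hash M" "PiE {..n div M} (\<lambda>_. {..<M})" n M "n div M + 1"
    by (rule shift_hash_family[OF M(1)])
  have "n ^ s * (t + 1) ^ s * n < 4 ^ t"
    using s(1) tn t8 sln by (intro request_count_less) auto
  then obtain Cd :: "(nat \<Rightarrow> bit) set" where "batch_code (n + 2 * t * M) n s t Cd"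
    using exists_batch_code[OF M(2) s(1) \<open>s \<le> t\<close>] by blast
  then show "\<exists>(N::nat) (Cd :: (nat \<Rightarrow> bit) set).
      batch_code N n s t Cd \<and> real N - real n \<le> 18 * real t powr (3/2) * sqrt (real n)"
    using M(3) by (intro exI[of _ "n + 2 * t * M"] exI[of _ Cd]) simp
qed

end
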